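(* Consider a natural gas network without compressors on a connected directed graph $\mathcal{G}=(\mathcal{N},\mathcal{P})$, with pipe coefficients $a_\ell>0$, $\ell\in\mathcal{P}$, a single fixed-pressure node $r$ with given pressure $\psi_r$, and balanced injections $\mathbf{q}\in\mathbb{R}^N$, $\sum_n q_n=0$. Suppose the gas flow problem is feasible. The unconstrained problem $$\min_{\boldsymbol{\psi}\in\mathbb{R}^N}\ \frac{2}{3}\sum_{\ell=(m,n)\in\mathcal{P}}\frac{|\psi_m-\psi_n|^{3/2}}{\sqrt{a_\ell}}-\mathbf{q}^\top\boldsymbol{\psi}$$ has a convex differentiable objective, and if $\boldsymbol{\psi}^*$ is a minimizer, shifted by a multiple of the all-ones vector so that its $r$-th entry equals the given $\psi_r$, then $\boldsymbol{\psi}^*$ together with the flows $$\phi_\ell=\mathrm{sign}(\psi_m^*-\psi_n^* )\sqrt{\frac{|\psi_m^*-\psi_n^*|}{a_\ell}},\qquad \ell=(m,n)\in\mathcal{P},$$ is the solution of the gas flow problem.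
   Context: $\mathcal{G}=(\mathcal{N},\mathcal{P})$ is a finite directed graph, connected when edge directions are ignored, with $\mathcal{N}=\{1,\dots,N\}$ and $P$ edges; if $(m,n)\in\mathcal{P}$ then $(n,m)\notin\mathcal{P}$. The edge-node incidence matrix $\mathbf{A}\in\mathbb{R}^{P\times N}$ has, in the row of $\ell=(m,n)$, entry $+1$ in column $m$, $-1$ in column $n$, and $0$ elsewhere. The gas flow problem (no compressors, single fixed-pressure node $r$) is: given $\mathbf{q}$ and $\psi_r$, find flows $\boldsymbol{\phi}\in\mathbb{R}^P$ and (squared) pressures $\boldsymbol{\psi}\in\mathbb{R}^N$, with $r$-th entry of $\boldsymbol{\psi}$ equal to the given value, such that $\mathbf{A}^\top\boldsymbol{\phi}=\mathbf{q}$, $\psi_m-\psi_n=a_\ell\,\mathrm{sign}(\phi_\ell)\phi_\ell^2$ for every $\ell=(m,n)\in\mathcal{P}$, and $\psi_n\ge0$ for all $n\in\mathcal{N}$. *)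

theory Defs
  imports "HOL-Analysis.Analysis"
begin

(* A network is given by its edge set P over a finite node type 'n. A vector in R^P is a
   function on pairs that is extensional on P (undefined off P), so that equality of flows
   is equality on the edges; P may be empty. *)

definition oriented_edges :: "('n \<times> 'n) set \<Rightarrow> bool" where
  "oriented_edges P \<longleftrightarrow> (\<forall>m n. (m, n) \<in> P \<longrightarrow> (n, m) \<notin> P)"

definition weakly_connected :: "('n \<times> 'n) set \<Rightarrow> bool" where
  "weakly_connected P \<longleftrightarrow> (\<forall>m n. (m, n) \<in> (P \<union> P\<inverse>)\<^sup>*)"

definition incidence :: "'n \<times> 'n \<Rightarrow> 'n \<Rightarrow> real" where
  "incidence l k = (if k = fst l then 1 else if k = snd l then - 1 else 0)"

definition gas_flow_solution ::
  "('n::finite \<times> 'n) set \<Rightarrow> ('n \<times> 'n \<Rightarrow> real) \<Rightarrow> real ^ 'n \<Rightarrow> 'n \<Rightarrow> real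
    \<Rightarrow> ('n \<times> 'n \<Rightarrow> real) \<Rightarrow> real ^ 'n \<Rightarrow> bool" where
  "gas_flow_solution P a q r psi_r \<phi> \<psi> \<longleftrightarrow>
     \<phi> \<in> extensional P \<and>
     \<psi> $ r = psi_r \<and>
     (\<forall>k. (\<Sum>l\<in>P. incidence l k * \<phi> l) = q $ k) \<and>
     (\<forall>(m, n)\<in>P. \<psi> $ m - \<psi> $ n = a (m, n) * sgn (\<phi> (m, n)) * (\<phi> (m, n))\<^sup>2) \<and>
     (\<forall>n. \<psi> $ n \<ge> 0)"

definition gas_objective ::
  "('n::finite \<times> 'n) set \<Rightarrow> ('n \<times> 'n \<Rightarrow> real) \<Rightarrow> real ^ 'n \<Rightarrow> real ^ 'n \<Rightarrow> real" where
  "gas_objective P a q \<psi> =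
     2 / 3 * (\<Sum>(m, n)\<in>P. \<bar>\<psi> $ m - \<psi> $ n\<bar> powr (3 / 2) / sqrt (a (m, n))) - q \<bullet> \<psi>"

definition pressure_flows ::
  "('n::finite \<times> 'n) set \<Rightarrow> ('n \<times> 'n \<Rightarrow> real) \<Rightarrow> real ^ 'n \<Rightarrow> 'n \<times> 'n \<Rightarrow> real" where
  "pressure_flows P a \<psi> =
     (\<lambda>(m, n)\<in>P. sgn (\<psi> $ m - \<psi> $ n) * sqrt (\<bar>\<psi> $ m - \<psi> $ n\<bar> / a (m, n)))"

end

theory Submission
  imports Defs
begin

text \<open>
  The gradient of the objective is the conservation law written in terms of the flows that
  the pressures induce, so a minimizer satisfies all the gas flow equations except possibly
  nonnegativity of the pressures. If two pressure vectors both induce conserving flows, then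
  the difference of the flows is orthogonal to the difference of the pressure drops, and since
  the flow on an edge is a strictly increasing function of the drop, the drops coincide; on a
  connected network this determines the pressures from their value at one node. Hence the
  shifted minimizer is the feasible solution that exists by assumption, and in particular it
  is nonnegative.
\<close>

section \<open>The pipe law and its inverse\<close>

text \<open>Isabelle's square root is odd on the reals, so \<open>sqrt x\<close> stands for
  \<open>sgn x * sqrt \<bar>x\<bar>\<close> throughout.\<close>

lemma sgn_mult_sqrt_abs:
  fixes x c :: real
  assumes "c > 0"
  shows "sgn x * sqrt (\<bar>x\<bar> / c) = sqrt (x / c)"
proof (cases "x < 0")
  case True
  then have "sqrt (\<bar>x\<bar> / c) = - sqrt (x / c)"
    by (simp flip: real_sqrt_minus)
  with True show ?thesis by simp
qed (auto simp: sgn_if)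

text \<open>The odd square root inverts \<open>sgn f * f\<^sup>2\<close>, so the drop along an edge
  determines its flow.\<close>

lemma eq_mult_sgn_mult_square_iff:
  fixes d c f :: real
  assumes "c > 0"
  shows "d = c * sgn f * f\<^sup>2 \<longleftrightarrow> f = sqrt (d / c)"
proof -
  have "sqrt (sgn f * f\<^sup>2) = f"
    by (cases f "0 :: real" rule: linorder_cases) (simp_all add: real_sqrt_minus)
  then have "f = sqrt (d / c) \<longleftrightarrow> sqrt (sgn f * f\<^sup>2) = sqrt (d / c)"
    by simp
  also have "\<dots> \<longleftrightarrow> sgn f * f\<^sup>2 = d / c"
    by (rule real_sqrt_eq_iff)
  also have "\<dots> \<longleftrightarrow> d = c * sgn f * f\<^sup>2"
    using assms by (auto simp: field_simps)
  finally show ?thesis by blast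
qed

section \<open>Calculus of the three-halves power\<close>

lemma abs_powr_three_halves:
  fixes x :: real
  shows "\<bar>x\<bar> powr (3 / 2) = x * sqrt x"
proof -
  have "\<bar>x\<bar> powr (1 + 1 / 2) = \<bar>x\<bar> * sqrt \<bar>x\<bar>"
    by (cases "x = 0") (simp_all only: powr_add, simp_all add: powr_half_sqrt)
  then show ?thesis
    by (cases "x \<ge> 0") (simp_all add: real_sqrt_minus)
qed

lemma has_real_derivative_abs_powr_three_halves:
  fixes x :: real
  shows "((\<lambda>x. \<bar>x\<bar> powr (3 / 2)) has_real_derivative 3 / 2 * sqrt x) (at x)"
proof (cases "x = 0")
  case True
  \<comment> \<open>The product rule fails at 0, where \<open>sqrt\<close> has no derivative; but
    the difference quotient there is \<open>sqrt h\<close> itself.\<close>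
  have "((\<lambda>h::real. sqrt h) \<longlongrightarrow> sqrt 0) (at 0)"
    by (intro tendsto_intros)
  then have "((\<lambda>h::real. h * sqrt h / h) \<longlongrightarrow> 0) (at 0)"
    by (simp cong: Lim_cong_within)
  with True show ?thesis
    by (simp add: abs_powr_three_halves has_field_derivative_iff)
next
  case False
  \<comment> \<open>The odd root is increasing on both sides of 0; \<open>sgn x\<close> makes the
    slope positive where \<open>sqrt x\<close> is negative.\<close>
  have "(sqrt has_real_derivative sgn x * (inverse (sqrt x) / 2)) (at x)"
    by (rule DERIV_real_sqrt_generic) (use False in \<open>auto simp: sgn_if\<close>)
  from DERIV_mult[OF DERIV_ident this]
  have "((\<lambda>x. x * sqrt x) has_real_derivative
      sqrt x + x * sgn x * inverse (sqrt x) / 2) (at x)"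
    by (simp add: mult_ac)
  also have "x * sgn x * inverse (sqrt x) = sqrt x"
  proof -
    have "x * sgn x = sqrt x * sqrt x"
      by (simp add: abs_sgn)
    then have "x * sgn x * inverse (sqrt x) = sqrt x * (sqrt x * inverse (sqrt x))"
      by (simp only: mult.assoc)
    with False show ?thesis by simp
  qed
  finally show ?thesis
    by (simp add: abs_powr_three_halves)
qed

text \<open>The derivative \<open>3 / 2 * sqrt x\<close> is nondecreasing on the whole line.\<close>

lemma convex_on_abs_powr_three_halves:
  "convex_on UNIV (\<lambda>x::real. \<bar>x\<bar> powr (3 / 2))"
  by (rule convex_on_realI[OF _ has_real_derivative_abs_powr_three_halves]) auto

section \<open>Convexity and gradient of the objective\<close>

lemma gas_objective_eq:
  "gas_objective P a q = (\<lambda>\<psi>. 2 / 3 *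
     (\<Sum>l\<in>P. \<bar>\<psi> $ fst l - \<psi> $ snd l\<bar> powr (3 / 2) / sqrt (a l)) - q \<bullet> \<psi>)"
  by (simp add: fun_eq_iff gas_objective_def case_prod_unfold)

text \<open>Each edge term is a convex function of the drop, which is linear in the pressures,
  scaled by a positive factor; the term in \<open>q\<close> is linear.\<close>

lemma convex_on_gas_objective:
  fixes P :: "('n::finite \<times> 'n) set"
  assumes pos: "\<And>l. l \<in> P \<Longrightarrow> a l > 0"
  shows "convex_on UNIV (gas_objective P a q)"
proof -
  have edge: "convex_on UNIV (\<lambda>\<psi>::real^'n. \<bar>\<psi> $ fst l - \<psi> $ snd l\<bar> powr (3 / 2) / sqrt (a l))"
    if "l \<in> P" for l
  proof -
    have "convex_on UNIV (\<lambda>\<psi>::real^'n. \<bar>\<psi> $ fst l - \<psi> $ snd l\<bar> powr (3 / 2))"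
    proof (rule convex_onI)
      fix t :: real and \<psi> \<xi> :: "real^'n"
      assume "0 < t" "t < 1"
      then show "\<bar>((1 - t) *\<^sub>R \<psi> + t *\<^sub>R \<xi>) $ fst l - ((1 - t) *\<^sub>R \<psi> + t *\<^sub>R \<xi>) $ snd l\<bar> powr (3 / 2)
        \<le> (1 - t) * \<bar>\<psi> $ fst l - \<psi> $ snd l\<bar> powr (3 / 2) + t * \<bar>\<xi> $ fst l - \<xi> $ snd l\<bar> powr (3 / 2)"
        using convex_onD[OF convex_on_abs_powr_three_halves, of t "\<psi> $ fst l - \<psi> $ snd l" "\<xi> $ fst l - \<xi> $ snd l"]
        by (simp add: algebra_simps)
    qed simp
    from convex_on_cmul[OF _ this, of "inverse (sqrt (a l))"] pos[OF that] show ?thesis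
      by (simp add: field_simps)
  qed
  have "convex_on UNIV (\<lambda>\<psi>::real^'n. \<Sum>l\<in>P. \<bar>\<psi> $ fst l - \<psi> $ snd l\<bar> powr (3 / 2) / sqrt (a l))"
    using finite[of P] edge
  proof (induction rule: finite_induct)
    case empty
    show ?case by (simp add: convex_on_const)
  next
    case (insert l F)
    from insert.hyps show ?case
      unfolding sum.insert[OF insert.hyps] by (intro convex_on_add insert) auto
  qed
  moreover have "convex_on UNIV (\<lambda>\<psi>. - (q \<bullet> \<psi>))"
    by (rule convex_onI) (auto simp: inner_simps)
  ultimately have "convex_on UNIV (\<lambda>\<psi>::real^'n. 2 / 3 *
      (\<Sum>l\<in>P. \<bar>\<psi> $ fst l - \<psi> $ snd l\<bar> powr (3 / 2) / sqrt (a l)) + - (q \<bullet> \<psi>))"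
    by (intro convex_on_add convex_on_cmul) simp_all
  then show ?thesis
    by (simp add: gas_objective_eq)
qed

text \<open>Chain rule along the linear drop. The factor 2/3 cancels the exponent 3/2, so for
  positive coefficients the drops of \<open>h\<close> are weighted by exactly the induced
  flows.\<close>

lemma has_derivative_gas_objective:
  fixes P :: "('n::finite \<times> 'n) set"
  shows "(gas_objective P a q has_derivative
    (\<lambda>h. (\<Sum>l\<in>P. (h $ fst l - h $ snd l) * sqrt ((\<psi> $ fst l - \<psi> $ snd l) / a l)) - q \<bullet> h)) (at \<psi>)"
proof -
  have edge: "((\<lambda>\<psi>::real^'n. \<bar>\<psi> $ fst l - \<psi> $ snd l\<bar> powr (3 / 2) / sqrt (a l)) has_derivative
      (\<lambda>h. (h $ fst l - h $ snd l) * (3 / 2 * sqrt (\<psi> $ fst l - \<psi> $ snd l) / sqrt (a l)))) (at \<psi>)" for l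
    by (rule DERIV_compose_FDERIV[OF DERIV_cdivide[OF has_real_derivative_abs_powr_three_halves]])
      (auto intro!: derivative_eq_intros bounded_linear.has_derivative[OF bounded_linear_vec_nth])
  have "(gas_objective P a q has_derivative (\<lambda>h. 2 / 3 *
      (\<Sum>l\<in>P. (h $ fst l - h $ snd l) * (3 / 2 * sqrt (\<psi> $ fst l - \<psi> $ snd l) / sqrt (a l))) - q \<bullet> h)) (at \<psi>)"
    unfolding gas_objective_eq
    by (intro has_derivative_diff has_derivative_mult_right has_derivative_sum edge
        has_derivative_inner_right has_derivative_ident)
  then show ?thesis
    by (simp add: sum_distrib_left real_sqrt_divide)
qed

section \<open>The incidence matrix and elimination of the flows\<close>

text \<open>Lets the derivative in direction \<open>axis k 1\<close> be read as the balance at node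
  \<open>k\<close>. Loops are excluded because \<open>incidence\<close> is 1 at the node of a loop,
  while the drop is 0.\<close>

lemma incidence_eq_axis:
  assumes "fst l \<noteq> snd l"
  shows "incidence l k = axis k 1 $ fst l - axis k 1 $ snd l"
  using assms by (auto simp: incidence_def axis_def)

lemma sum_incidence_mult:
  fixes h :: "real ^ 'n::finite"
  assumes "fst l \<noteq> snd l"
  shows "(\<Sum>k\<in>UNIV. incidence l k * h $ k) = h $ fst l - h $ snd l"
proof -
  have "(\<Sum>k\<in>UNIV. incidence l k * h $ k)
      = (\<Sum>k\<in>UNIV. (if fst l = k then h $ k else 0) - (if snd l = k then h $ k else 0))"
    using assms by (intro sum.cong) (auto simp: incidence_def)
  then show ?thesis
    by (simp add: sum_subtractf)
qed

lemma pressure_flows_eq: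
  assumes "\<And>l. l \<in> P \<Longrightarrow> a l > 0" and "l \<in> P"
  shows "pressure_flows P a \<psi> l = sqrt ((\<psi> $ fst l - \<psi> $ snd l) / a l)"
  using assms by (cases l) (auto simp: pressure_flows_def sgn_mult_sqrt_abs)

text \<open>Inverting the pipe law leaves conditions on the pressures alone; extensionality turns
  agreement on the edges into equality of the flow functions.\<close>

lemma gas_flow_solution_iff:
  assumes "\<And>l. l \<in> P \<Longrightarrow> a l > 0"
  shows "gas_flow_solution P a q r psi_r \<phi> \<psi> \<longleftrightarrow>
    \<phi> = pressure_flows P a \<psi> \<and> \<psi> $ r = psi_r \<and>
    (\<forall>k. (\<Sum>l\<in>P. incidence l k * pressure_flows P a \<psi> l) = q $ k) \<and> (\<forall>n. \<psi> $ n \<ge> 0)"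
proof -
  have "pressure_flows P a \<psi> \<in> extensional P"
    by (simp add: pressure_flows_def)
  moreover have "(\<forall>(m, n)\<in>P. \<psi> $ m - \<psi> $ n = a (m, n) * sgn (\<phi> (m, n)) * (\<phi> (m, n))\<^sup>2)
      \<longleftrightarrow> (\<forall>l\<in>P. \<phi> l = pressure_flows P a \<psi> l)"
    using assms by (auto simp: eq_mult_sgn_mult_square_iff pressure_flows_eq)
  ultimately have "\<phi> \<in> extensional P \<and>
      (\<forall>(m, n)\<in>P. \<psi> $ m - \<psi> $ n = a (m, n) * sgn (\<phi> (m, n)) * (\<phi> (m, n))\<^sup>2)
      \<longleftrightarrow> \<phi> = pressure_flows P a \<psi>"
    by (auto intro: extensionalityI)
  then show ?thesis
    unfolding gas_flow_solution_def by blast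
qed

section \<open>Minimizers conserve flow; conserving pressures are unique\<close>

lemma conservation_if_minimizer:
  fixes P :: "('n::finite \<times> 'n) set"
  assumes pos: "\<And>l. l \<in> P \<Longrightarrow> a l > 0" and loopfree: "\<And>l. l \<in> P \<Longrightarrow> fst l \<noteq> snd l"
    and min: "\<And>\<xi>. gas_objective P a q \<psi> \<le> gas_objective P a q \<xi>"
  shows "(\<Sum>l\<in>P. incidence l k * pressure_flows P a \<psi> l) = q $ k"
proof -
  have "(\<lambda>h. (\<Sum>l\<in>P. (h $ fst l - h $ snd l) * sqrt ((\<psi> $ fst l - \<psi> $ snd l) / a l)) - q \<bullet> h) = (\<lambda>h. 0)"
    by (rule differential_zero_maxmin[OF _ open_UNIV has_derivative_gas_objective]) (use min in auto)
  from fun_cong[OF this, of "axis k 1"]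
  have "(\<Sum>l\<in>P. (axis k 1 $ fst l - axis k 1 $ snd l) * sqrt ((\<psi> $ fst l - \<psi> $ snd l) / a l)) = q $ k"
    by (simp add: inner_axis)
  moreover have "(\<Sum>l\<in>P. incidence l k * pressure_flows P a \<psi> l)
      = (\<Sum>l\<in>P. (axis k 1 $ fst l - axis k 1 $ snd l) * sqrt ((\<psi> $ fst l - \<psi> $ snd l) / a l))"
    by (intro sum.cong refl) (simp add: incidence_eq_axis pressure_flows_eq pos loopfree)
  ultimately show ?thesis by simp
qed

lemma eq_drops_if_eq_divergence:
  fixes P :: "('n::finite \<times> 'n) set"
  assumes pos: "\<And>l. l \<in> P \<Longrightarrow> a l > 0" and loopfree: "\<And>l. l \<in> P \<Longrightarrow> fst l \<noteq> snd l"
    and eq: "\<And>k. (\<Sum>l\<in>P. incidence l k * pressure_flows P a \<psi> l)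
      = (\<Sum>l\<in>P. incidence l k * pressure_flows P a \<xi> l)"
    and "l \<in> P"
  shows "\<psi> $ fst l - \<psi> $ snd l = \<xi> $ fst l - \<xi> $ snd l"
proof -
  let ?d = "\<lambda>\<psi> l. \<psi> $ fst l - \<psi> $ snd l"
  let ?f = "pressure_flows P a"
  \<comment> \<open>In matrix terms the sum of \<open>t\<close> pairs
    \<open>A (\<psi> - \<xi>)\<close> with the flow difference; moving \<open>A\<close> to the other
    side as its transpose gives the difference of divergences, which is 0.\<close>
  define t where "t l = (?d \<psi> l - ?d \<xi> l) * (?f \<psi> l - ?f \<xi> l)" for l
  have "(\<Sum>l\<in>P. t l) = (\<Sum>l\<in>P. \<Sum>k\<in>UNIV. (\<psi> - \<xi>) $ k * (incidence l k * (?f \<psi> l - ?f \<xi> l)))"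
  proof (intro sum.cong refl)
    fix l assume "l \<in> P"
    have "t l = (\<Sum>k\<in>UNIV. incidence l k * (\<psi> - \<xi>) $ k) * (?f \<psi> l - ?f \<xi> l)"
      unfolding sum_incidence_mult[OF loopfree[OF \<open>l \<in> P\<close>]] by (simp add: t_def algebra_simps)
    then show "t l = (\<Sum>k\<in>UNIV. (\<psi> - \<xi>) $ k * (incidence l k * (?f \<psi> l - ?f \<xi> l)))"
      by (simp add: sum_distrib_left sum_distrib_right mult_ac)
  qed
  also have "\<dots> = (\<Sum>k\<in>UNIV. (\<psi> - \<xi>) $ k *
      ((\<Sum>l\<in>P. incidence l k * ?f \<psi> l) - (\<Sum>l\<in>P. incidence l k * ?f \<xi> l)))"
    by (subst sum.swap) (simp only: sum_distrib_left sum_subtractf right_diff_distrib)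
  also have "\<dots> = 0"
    by (simp add: eq)
  finally have sum0: "(\<Sum>l\<in>P. t l) = 0" .
  \<comment> \<open>As \<open>sqrt\<close> is strictly increasing, the two factors of
    \<open>t l\<close> have the same sign and vanish together.\<close>
  have nonneg: "t l \<ge> 0" and strict: "t l = 0 \<Longrightarrow> ?d \<psi> l = ?d \<xi> l" if "l \<in> P" for l
  proof -
    have f: "?f \<psi> l = sqrt (?d \<psi> l / a l)" "?f \<xi> l = sqrt (?d \<xi> l / a l)"
      using pos that by (simp_all add: pressure_flows_eq)
    have a: "a l > 0" using pos that .
    show "t l \<ge> 0"
      unfolding t_def f zero_le_mult_iff using a
      by (auto simp: divide_le_cancel)
    show "?d \<psi> l = ?d \<xi> l" if "t l = 0"
      using that a unfolding t_def f by (auto simp: divide_cancel_right)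
  qed
  show ?thesis
    using sum_nonneg_eq_0_iff[of P t] sum0 nonneg strict \<open>l \<in> P\<close> by auto
qed

text \<open>Equality at \<open>r\<close> spreads along an undirected path, since an equal drop
  passes it across an edge in either direction.\<close>

lemma eq_if_eq_drops:
  fixes \<psi> \<xi> :: "real ^ 'n::finite"
  assumes "weakly_connected P"
    and drops: "\<And>l. l \<in> P \<Longrightarrow> \<psi> $ fst l - \<psi> $ snd l = \<xi> $ fst l - \<xi> $ snd l"
    and "\<psi> $ r = \<xi> $ r"
  shows "\<psi> = \<xi>"
proof -
  have "\<psi> $ n = \<xi> $ n" for n
  proof -
    have "(r, n) \<in> (P \<union> P\<inverse>)\<^sup>*"
      using assms(1) by (simp add: weakly_connected_def)
    then show ?thesis
      by (induction rule: rtrancl_induct) (use assms(3) drops in fastforce)+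
  qed
  then show ?thesis by (simp add: vec_eq_iff)
qed

theorem mainTheorem4:
  fixes P :: "('n::finite \<times> 'n) set"
    and a :: "'n \<times> 'n \<Rightarrow> real"
    and q :: "real ^ 'n"
    and r :: 'n
    and psi_r :: real
  assumes "oriented_edges P"
    and "weakly_connected P"
    and "\<forall>l\<in>P. a l > 0"
    and "(\<Sum>n\<in>UNIV. q $ n) = 0"
    and "\<exists>\<phi> \<psi>. gas_flow_solution P a q r psi_r \<phi> \<psi>"
  shows "convex_on UNIV (gas_objective P a q) \<and>
    (\<forall>\<psi>. gas_objective P a q differentiable (at \<psi>)) \<and>
    (\<forall>\<psi> \<psi>' c. (\<forall>\<xi>. gas_objective P a q \<psi> \<le> gas_objective P a q \<xi>) \<and>
        \<psi>' = \<psi> + c *\<^sub>R (\<chi> n. 1) \<and> \<psi>' $ r = psi_r \<longrightarrow>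
        (\<forall>\<phi>'' \<psi>''. gas_flow_solution P a q r psi_r \<phi>'' \<psi>'' \<longleftrightarrow>
            \<phi>'' = pressure_flows P a \<psi>' \<and> \<psi>'' = \<psi>'))"
proof (intro conjI allI impI)
  have pos: "\<And>l. l \<in> P \<Longrightarrow> a l > 0"
    using assms(3) by blast
  \<comment> \<open>A loop would be its own reversal.\<close>
  have loopfree: "\<And>l. l \<in> P \<Longrightarrow> fst l \<noteq> snd l"
    using assms(1) unfolding oriented_edges_def by (metis prod.collapse)
  show "convex_on UNIV (gas_objective P a q)"
    using pos by (rule convex_on_gas_objective)
  show "gas_objective P a q differentiable (at \<psi>)" for \<psi>
    using has_derivative_gas_objective by (rule differentiableI)
  fix \<psi> \<psi>' :: "real^'n" and c \<phi>'' \<psi>''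
  assume asm: "(\<forall>\<xi>. gas_objective P a q \<psi> \<le> gas_objective P a q \<xi>) \<and>
        \<psi>' = \<psi> + c *\<^sub>R (\<chi> n. 1) \<and> \<psi>' $ r = psi_r"
  then have root: "\<psi>' $ r = psi_r"
    by blast
  \<comment> \<open>The shift by a multiple of the all-ones vector cancels in every drop.\<close>
  from asm have "pressure_flows P a \<psi>' = pressure_flows P a \<psi>"
    by (auto simp: pressure_flows_def)
  then have cons: "(\<Sum>l\<in>P. incidence l k * pressure_flows P a \<psi>' l) = q $ k" for k
    using conservation_if_minimizer[OF pos loopfree] asm by simp
  note sol_iff = gas_flow_solution_iff[OF pos]
  have unique: "\<xi> = \<psi>'" if "gas_flow_solution P a q r psi_r \<phi> \<xi>" for \<phi> \<xi>
  proof (rule eq_if_eq_drops[OF assms(2)])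
    show "\<xi> $ fst l - \<xi> $ snd l = \<psi>' $ fst l - \<psi>' $ snd l" if "l \<in> P" for l
      by (rule eq_drops_if_eq_divergence[OF pos loopfree _ that])
        (use \<open>gas_flow_solution P a q r psi_r \<phi> \<xi>\<close> cons in \<open>auto simp: sol_iff\<close>)
    show "\<xi> $ r = \<psi>' $ r"
      using that root by (simp add: sol_iff)
  qed
  \<comment> \<open>Feasibility supplies nonnegativity: the given solution has pressures
    \<open>\<psi>'\<close> by uniqueness.\<close>
  from assms(5) obtain \<phi> \<xi> where sol: "gas_flow_solution P a q r psi_r \<phi> \<xi>"
    by blast
  with unique[OF sol] have "gas_flow_solution P a q r psi_r (pressure_flows P a \<psi>') \<psi>'"
    by (simp add: sol_iff)
  moreover have "\<phi>'' = pressure_flows P a \<psi>''" if "gas_flow_solution P a q r psi_r \<phi>'' \<psi>''"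
    using that by (simp add: sol_iff)
  ultimately show "gas_flow_solution P a q r psi_r \<phi>'' \<psi>'' \<longleftrightarrow>
      \<phi>'' = pressure_flows P a \<psi>' \<and> \<psi>'' = \<psi>'"
    using unique by blast
qed

end
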